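(* Let $k,p\ge 0$ be integers. For each $n\ge 0$ let $D_n$ be the number of Dyck paths of semilength $n$ belonging to the class $\mathcal{D}_{k,p}$ (for $k,p\ge 1$ these are exactly the Dyck paths of semilength $n$ that start with at least $k$ upsteps, end with at least $p$ downsteps, and touch the $x$-axis somewhere between the first upstep and the last downstep). Then, as formal power series, $$D_{k,p}(x):=\sum_{n\ge 0} D_n x^n = x^{p+k}\,C(x)^{k+p+1},$$ and for every $n\ge 0$, $$D_n=\frac{k+p+1}{n+1}\binom{2n-k-p}{n}.$$
   Context: A Dyck path of semilength $n$ is a lattice path from $(0,0)$ to $(2n,0)$ consisting of upsteps $(1,1)$ and downsteps $(1,-1)$ that never goes below the $x$-axis; the empty path is the Dyck path of semilength $0$. For integers $k,p\ge 0$, $\mathcal{P}_{k,p}$ is the class of all Dyck paths that start with at least $k$ upsteps and end with at least $p$ downsteps. The class $\mathcal{D}_{k,p}$ consists of all paths in $\mathcal{P}_{k,p}$ that are a concatenation of two or more Dyck paths (components) such that at least one of the components is of semilength at least $k$ and another (a different component) is of semilength at least $p$. Components are allowed to be empty (so when $k$ or $p$ is $0$ the path is not required to touch the $x$-axis between its endpoints; e.g. $\mathcal{D}_{0,0}$ is the class of all Dyck paths, including the empty one, and $\mathcal{D}_{1,0}=\mathcal{D}_{0,1}$ is the class of all non-empty Dyck paths). $C(x)=\frac{1-\sqrt{1-4x}}{2x}=\sum_{n\ge 0}\frac{1}{n+1}\binom{2n}{n}x^n$ is the Catalan generating function. Convention: $\binom{m}{n}=0$ whenever $m<n$ (including negative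 $m$). *)

theory Defs
  imports "HOL-Computational_Algebra.Formal_Power_Series"
begin

datatype step = Up | Down

fun rise :: "step \<Rightarrow> int" where
  "rise Up = 1"
| "rise Down = -1"

text \<open>A path starting at the origin is the list of its steps: after its first \<open>i\<close> steps the path
  \<open>w\<close> is at the point \<open>(i, height (take i w))\<close>.\<close>

definition height :: "step list \<Rightarrow> int" where
  "height w = (\<Sum>s\<leftarrow>w. rise s)"

definition dyck_path :: "step list \<Rightarrow> bool" where
  "dyck_path w \<longleftrightarrow> height w = 0 \<and> (\<forall>i\<le>length w. 0 \<le> height (take i w))"

text \<open>A path of height \<open>0\<close> has even length, so no rounding occurs on Dyck paths.\<close>

definition semilength :: "step list \<Rightarrow> nat" where
  "semilength w = length w div 2"

definition class_P :: "nat \<Rightarrow> nat \<Rightarrow> step list set" where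
  "class_P k p = {w. dyck_path w \<and> (\<exists>v. w = replicate k Up @ v) \<and> (\<exists>v. w = v @ replicate p Down)}"

text \<open>The components in \<open>cs\<close> are arbitrary Dyck paths, not necessarily prime and possibly empty.
  The two distinguished components are at different positions, in either order; they may be
  equal as step lists.\<close>

definition class_D :: "nat \<Rightarrow> nat \<Rightarrow> step list set" where
  "class_D k p = {w \<in> class_P k p. \<exists>cs. w = concat cs \<and> 2 \<le> length cs \<and> (\<forall>c\<in>set cs. dyck_path c) \<and>
     (\<exists>i<length cs. \<exists>j<length cs. i \<noteq> j \<and> k \<le> semilength (cs ! i) \<and> p \<le> semilength (cs ! j))}"

definition num_D :: "nat \<Rightarrow> nat \<Rightarrow> nat \<Rightarrow> nat" where
  "num_D k p n = card {w \<in> class_D k p. length w = 2 * n}"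

text \<open>For a Dyck path \<open>w\<close>, strictly between the endpoints is the same as between the first upstep
  and the last downstep, since a non-empty Dyck path begins with an upstep and ends with a downstep.\<close>

definition touches_axis_inside :: "step list \<Rightarrow> bool" where
  "touches_axis_inside w \<longleftrightarrow> (\<exists>i. 0 < i \<and> i < length w \<and> height (take i w) = 0)"

text \<open>Division by \<open>2 * x\<close> in \<open>(1 - sqrt (1 - 4 * x)) / (2 * x)\<close> is avoided by taking the
  coefficients of this series, the Catalan numbers.\<close>

definition catalan_fps :: "rat fps" where
  "catalan_fps = Abs_fps (\<lambda>n. 1 / of_nat (n + 1) * of_nat ((2 * n) choose n))"

text \<open>The upper argument is an integer because \<open>2 * n - k - p\<close> may be negative. For \<open>n = 0\<close> and
  negative \<open>m\<close> the value is \<open>0\<close>, unlike \<open>m gchoose 0\<close> and unlike truncating \<open>m\<close> to a natural number.\<close>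

definition binom :: "int \<Rightarrow> nat \<Rightarrow> nat" where
  "binom m n = (if m < int n then 0 else nat m choose n)"

end

theory Submission
  imports Defs
begin

text \<open>A path in \<open>\<D>\<^sub>k\<^sub>,\<^sub>p\<close> is \<open>Up\<^sup>k v Down\<^sup>p\<close> where \<open>v\<close> leads from height \<open>k\<close> to height \<open>p\<close>, stays
  non-negative and meets height \<open>0\<close>. Splitting off the first step of \<open>v\<close> shows that the number of
  such \<open>v\<close> depends only on \<open>m = k + p\<close> and on the length, and that it satisfies
  \<open>F (n + 1, m + 1) = F (n, m) + F (n + 1, m + 2)\<close>, the recurrence of the closed form.
  The generating functions \<open>H\<^sub>m\<close> of \<open>F (\<cdot>, m)\<close> then satisfy \<open>H\<^sub>m\<^sub>+\<^sub>2 = H\<^sub>m\<^sub>+\<^sub>1 - x H\<^sub>m\<close>. The Casoratian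
  \<open>H\<^sub>m\<^sub>+\<^sub>1\<^sup>2 - H\<^sub>m H\<^sub>m\<^sub>+\<^sub>2\<close> of this recurrence is \<open>x\<^sup>m\<close> times its initial value, but it is divisible by
  \<open>x\<^sup>2\<^sup>m\<close>, so it vanishes; for \<open>m = 0\<close> this is \<open>C = 1 + x C\<^sup>2\<close>, and \<open>H\<^sub>m = x\<^sup>m C\<^sup>m\<^sup>+\<^sup>1\<close> follows.\<close>

section \<open>Ballot numbers and powers of the Catalan series\<close>

definition ballot :: "nat \<Rightarrow> nat \<Rightarrow> rat" where
  "ballot n m = of_nat (m + 1) / of_nat (n + 1) * of_nat (binom (2 * int n - int m) n)"

lemma ballot_le: "m \<le> n \<Longrightarrow> ballot n m = of_nat (m + 1) / of_nat (n + 1) * of_nat ((2 * n - m) choose n)"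
proof -
  assume "m \<le> n"
  then have "nat (2 * int n - int m) = 2 * n - m" and "\<not> 2 * int n - int m < int n" by linarith+
  then show ?thesis unfolding ballot_def binom_def by simp
qed

lemma ballot_gt: "n < m \<Longrightarrow> ballot n m = 0"
  by (simp add: ballot_def binom_def)

text \<open>In the base case of the path count the length is 0, so the index \<open>a + b\<close>
  equals \<open>2 * n\<close>.\<close>

lemma ballot_double: "ballot n (2 * n) = (if n = 0 then 1 else 0)"
  by (cases "n = 0") (simp_all add: ballot_gt ballot_le)

text \<open>By Pascal's rule all three terms are combinations of the neighbours \<open>a\<close> and
  \<open>b\<close> in row \<open>2 * n - m\<close>. Absorption gives their ratio, and a rational
  identity remains.\<close>

lemma ballot_Suc_Suc: "ballot (Suc n) (Suc m) = ballot n m + ballot (Suc n) (Suc (Suc m))"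
proof (cases "m \<le> n")
  case False
  then show ?thesis by (simp add: ballot_gt)
next
  case True
  define a b :: rat where "a = of_nat ((2 * n - m) choose n)" and "b = of_nat ((2 * n - m) choose Suc n)"
  have 1: "ballot n m = of_nat (m + 1) / of_nat (n + 1) * a"
    using True by (simp add: ballot_le a_def)
  have "2 * Suc n - Suc m = Suc (2 * n - m)" using True by simp
  then have 2: "ballot (Suc n) (Suc m) = of_nat (m + 2) / of_nat (n + 2) * (a + b)"
    using True by (simp add: ballot_le a_def b_def del: mult_Suc_right)
  have 3: "ballot (Suc n) (Suc (Suc m)) = of_nat (m + 3) / of_nat (n + 2) * b"
  \<comment> \<open>At \<open>m = n\<close> the left side is 0 by the convention in
    \<open>binom\<close>, and \<open>b\<close> is \<open>n choose Suc n\<close>, also 0.\<close>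
  proof (cases "m = n")
    case True
    then show ?thesis by (simp add: ballot_gt b_def)
  next
    case False
    then show ?thesis using True by (simp add: ballot_le b_def)
  qed
  have "Suc n * ((2 * n - m) choose Suc n) = (2 * n - m - n) * ((2 * n - m) choose n)"
    by (metis binomial_absorb_comp binomial_absorption mult.commute)
  then have "Suc n * ((2 * n - m) choose Suc n) = (n - m) * ((2 * n - m) choose n)"
    using True by simp
  then have "of_nat (Suc n) * b = of_nat (n - m) * a"
    unfolding a_def b_def by (metis of_nat_mult)
  then have "(of_nat n + 1) * b = (of_nat n - of_nat m) * a"
    using True by (simp add: of_nat_diff add.commute)
  then have b: "b = (of_nat n - of_nat m) * a / (of_nat n + 1)"
    by (metis add.commute mult.commute nonzero_mult_div_cancel_right of_nat_Suc of_nat_neq_0)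
  have nz: "rat_of_nat n + 1 \<noteq> 0" "rat_of_nat n + 2 \<noteq> 0"
    by (metis add.commute of_nat_Suc of_nat_neq_0) (metis of_nat_0_le_iff add_nonneg_pos zero_less_numeral less_irrefl)
  show ?thesis unfolding 1 2 3 b using nz by (simp add: divide_simps) algebra
qed

text \<open>The symmetry of row \<open>2 * n + 1\<close> makes the central binomial coefficient
  twice its neighbour above. This serves for paths from the axis to the axis.\<close>

lemma ballot_Suc_0: "ballot (Suc n) 0 = ballot (Suc n) (Suc 0)"
proof -
  have "(2 * Suc n) choose Suc n = 2 * ((2 * Suc n - 1) choose Suc n)"
    using binomial_symmetric[of n "Suc (2 * n)"] by simp
  then show ?thesis by (simp add: ballot_le)
qed

section \<open>Generating functions and the quadratic equation for the Catalan series\<close>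

definition ballot_fps :: "nat \<Rightarrow> rat fps" where
  "ballot_fps m = Abs_fps (\<lambda>n. ballot n m)"

lemma ballot_fps_0: "ballot_fps 0 = catalan_fps"
  by (simp add: ballot_fps_def catalan_fps_def ballot_le)

text \<open>The \<open>- 1\<close> corrects coefficient 0, which \<open>ballot_Suc_0\<close> does
  not cover.\<close>

lemma ballot_fps_1: "ballot_fps (Suc 0) = ballot_fps 0 - 1"
proof (rule fps_ext)
  fix n show "fps_nth (ballot_fps (Suc 0)) n = fps_nth (ballot_fps 0 - 1) n"
    by (cases n) (simp_all add: ballot_fps_def ballot_Suc_0 ballot_le[of 0 0] ballot_gt)
qed

lemma ballot_fps_Suc_Suc:
  "ballot_fps (Suc (Suc m)) = ballot_fps (Suc m) - fps_X * ballot_fps m"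
proof (rule fps_ext)
  fix n show "fps_nth (ballot_fps (Suc (Suc m))) n = fps_nth (ballot_fps (Suc m) - fps_X * ballot_fps m) n"
    by (cases n) (simp_all add: ballot_fps_def ballot_Suc_Suc[of _ m] ballot_gt)
qed

lemma fps_X_power_dvd_ballot_fps: "fps_X ^ m dvd ballot_fps m"
proof (cases "ballot_fps m = 0")
  case False
  then have "m \<le> subdegree (ballot_fps m)"
    by (intro subdegree_geI) (simp_all add: ballot_fps_def ballot_gt)
  then show ?thesis using False by (simp add: fps_dvd_iff)
qed simp

text \<open>Each shift of the index multiplies the Casoratian by minus the coefficient of
  \<open>ballot_fps m\<close> in the recurrence, that is by \<open>fps_X\<close>.\<close>

lemma ballot_fps_Casoratian:
  "ballot_fps (Suc m) ^ 2 - ballot_fps m * ballot_fps (Suc (Suc m)) =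
   fps_X ^ m * (ballot_fps 1 ^ 2 - ballot_fps 0 * ballot_fps 2)"
proof (induction m)
  case 0
  then show ?case by (simp add: numeral_2_eq_2)
next
  case (Suc m)
  have "ballot_fps (Suc (Suc m)) ^ 2 - ballot_fps (Suc m) * ballot_fps (Suc (Suc (Suc m))) =
    fps_X * (ballot_fps (Suc m) ^ 2 - ballot_fps m * ballot_fps (Suc (Suc m)))"
    unfolding ballot_fps_Suc_Suc by algebra
  then show ?case using Suc by simp
qed

lemma catalan_fps_eq: "catalan_fps = 1 + fps_X * catalan_fps ^ 2"
proof -
  define W where "W = ballot_fps 1 ^ 2 - ballot_fps 0 * ballot_fps 2"
  \<comment> \<open>Both products in the Casoratian contain \<open>fps_X ^ (2 * m + 2)\<close>;
    cancelling \<open>fps_X ^ m\<close> still leaves more than \<open>m\<close> factors, for every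
    \<open>m\<close>.\<close>
  have dvd: "fps_X ^ Suc m dvd W" for m
  proof -
    have "fps_X ^ (Suc m + Suc m) dvd ballot_fps (Suc m) ^ 2"
      unfolding power2_eq_square power_add by (intro mult_dvd_mono fps_X_power_dvd_ballot_fps)
    moreover have "fps_X ^ (m + Suc (Suc m)) dvd ballot_fps m * ballot_fps (Suc (Suc m))"
      unfolding power_add[of _ m "Suc (Suc m)"] by (intro mult_dvd_mono fps_X_power_dvd_ballot_fps)
    ultimately have "fps_X ^ (m + Suc (Suc m)) dvd fps_X ^ m * W"
      unfolding W_def ballot_fps_Casoratian[symmetric] by (simp add: dvd_diff)
    then have "fps_X ^ Suc (Suc m) dvd W"
      by (simp add: power_add)
    then show ?thesis by (rule power_le_dvd) simp
  qed
  have "W = 0"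
  proof (rule ccontr)
    assume "W \<noteq> 0"
    then show False using dvd[of "subdegree W"] by (simp add: fps_dvd_iff del: power_Suc)
  qed
  \<comment> \<open>This is \<open>W = 0\<close> written in \<open>catalan_fps\<close> alone; on
    expansion the squares without \<open>fps_X\<close> cancel.\<close>
  then have "(catalan_fps - 1) ^ 2 = catalan_fps * (catalan_fps - 1 - fps_X * catalan_fps)"
    by (simp add: W_def numeral_2_eq_2 ballot_fps_Suc_Suc ballot_fps_1 ballot_fps_0)
  then show ?thesis by algebra
qed

lemma ballot_fps_eq: "ballot_fps m = fps_X ^ m * catalan_fps ^ (m + 1)"
proof (induction m rule: induct_nat_012)
  case 0
  then show ?case by (simp add: ballot_fps_0)
next
  case 1
  then show ?case
    using catalan_fps_eq
    by (simp add: ballot_fps_1 ballot_fps_0 power2_eq_square del: diff_eq_eq) (metis add_diff_cancel_left')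
next
  case (ge2 m)
  have "ballot_fps (Suc (Suc m)) =
      fps_X * (fps_X ^ m * catalan_fps ^ (m + 1)) * (catalan_fps - 1)"
    unfolding ballot_fps_Suc_Suc ge2 by (simp add: algebra_simps)
  also have "catalan_fps - 1 = fps_X * catalan_fps ^ 2"
    by (metis catalan_fps_eq add_diff_cancel_left')
  finally show ?case by (simp add: power2_eq_square algebra_simps)
qed

section \<open>Non-negative paths that meet the axis\<close>

text \<open>The starting height is an integer parameter, so removing the first step only shifts it,
  even below the axis.\<close>

definition stays :: "int \<Rightarrow> step list \<Rightarrow> bool" where
  "stays a v \<longleftrightarrow> (\<forall>i\<le>length v. 0 \<le> a + height (take i v))"

definition touches :: "int \<Rightarrow> step list \<Rightarrow> bool" where
  "touches a v \<longleftrightarrow> (\<exists>i\<le>length v. a + height (take i v) = 0)"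

lemma height_simps [simp]:
  "height [] = 0" "height (s # v) = rise s + height v" "height (u @ v) = height u + height v"
  "height (replicate k Up) = int k" "height (replicate k Down) = - int k"
  by (simp_all add: height_def sum_list_replicate)

lemma abs_height_le: "\<bar>height v\<bar> \<le> int (length v)"
proof (induction v)
  case (Cons s v)
  then show ?case by (cases s) auto
qed simp

lemma all_le_Suc: "(\<forall>i\<le>Suc n. P i) \<longleftrightarrow> P 0 \<and> (\<forall>i\<le>n. P (Suc i))"
  using All_less_Suc2[of "Suc n" P] by (simp add: less_Suc_eq_le)

lemma stays_Nil [simp]: "stays a [] \<longleftrightarrow> 0 \<le> a"
  by (simp add: stays_def)

lemma stays_Cons [simp]: "stays a (s # v) \<longleftrightarrow> 0 \<le> a \<and> stays (a + rise s) v"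
  by (simp add: stays_def all_le_Suc add.assoc)

lemma touches_Nil [simp]: "touches a [] \<longleftrightarrow> a = 0"
  by (simp add: touches_def)

lemma touches_Cons [simp]: "touches a (s # v) \<longleftrightarrow> a = 0 \<or> touches (a + rise s) v"
  using all_le_Suc[of "length v" "\<lambda>i. a + height (take i (s # v)) \<noteq> 0"]
  by (auto simp: touches_def add.assoc)

lemma stays_nonneg: "stays a v \<Longrightarrow> 0 \<le> a"
  by (cases v) auto

lemma stays_append [simp]: "stays a (u @ v) \<longleftrightarrow> stays a u \<and> stays (a + height u) v"
  by (induction u arbitrary: a) (auto dest: stays_nonneg simp: add.assoc)

lemma stays_end: "stays a v \<Longrightarrow> 0 \<le> a + height v"
  by (auto simp: stays_def)

lemma stays_replicate:
  "0 \<le> a \<Longrightarrow> stays a (replicate k Up)" "int k \<le> a \<Longrightarrow> stays a (replicate k Down)"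
  by (induction k arbitrary: a) auto

lemma touches_0: "touches 0 v"
  by (cases v) auto

lemma touches_iff_append: "touches a v \<longleftrightarrow> (\<exists>u u'. v = u @ u' \<and> a + height u = 0)"
proof
  assume "touches a v"
  then obtain i where "a + height (take i v) = 0" by (auto simp: touches_def)
  then show "\<exists>u u'. v = u @ u' \<and> a + height u = 0"
    by (intro exI[of _ "take i v"] exI[of _ "drop i v"]) simp
next
  assume "\<exists>u u'. v = u @ u' \<and> a + height u = 0"
  then obtain u u' where "v = u @ u'" "a + height u = 0" by blast
  then show "touches a v" unfolding touches_def by (intro exI[of _ "length u"]) simp
qed

text \<open>Heights are integers, so a path that avoids the axis can be lowered by one.\<close>

lemma stays_iff_not_touches: "stays a v \<longleftrightarrow> stays (a + 1) v \<and> \<not> touches (a + 1) v"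
proof -
  have *: "0 \<le> a + h \<longleftrightarrow> 0 \<le> a + 1 + h \<and> a + 1 + h \<noteq> 0" for h :: int by linarith
  show ?thesis unfolding stays_def touches_def using * by blast
qed

lemma dyck_path_iff: "dyck_path w \<longleftrightarrow> height w = 0 \<and> stays 0 w"
  by (simp add: dyck_path_def stays_def)

section \<open>Counting by the first step\<close>

definition touching_paths :: "nat \<Rightarrow> int \<Rightarrow> int \<Rightarrow> step list set" where
  "touching_paths l a b = {v. length v = l \<and> stays a v \<and> touches a v \<and> a + height v = b}"

lemma finite_touching_paths: "finite (touching_paths l a b)"
proof -
  have "(UNIV :: step set) = {Up, Down}" using step.exhaust by auto
  then have "finite (UNIV :: step set)" by (metis finite.emptyI finite_insert)
  then have "finite {v :: step list. set v \<subseteq> UNIV \<and> length v = l}"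
    by (rule finite_lists_length_eq)
  then show ?thesis by (rule finite_subset[rotated]) (auto simp: touching_paths_def)
qed

lemma touching_paths_Suc_pos:
  assumes "0 < a"
  shows "touching_paths (Suc l) a b =
    (#) Up ` touching_paths l (a + 1) b \<union> (#) Down ` touching_paths l (a - 1) b" (is "?A = ?B")
proof (intro equalityI subsetI)
  fix w assume "w \<in> ?A"
  then show "w \<in> ?B" using assms
    by (cases w; cases "hd w") (auto simp: touching_paths_def algebra_simps)
qed (use assms in \<open>auto simp: touching_paths_def\<close>)

text \<open>The start already touches the axis, so the rest after \<open>Up\<close> only has to stay
  non-negative. Either it touches the axis, or lowering it by one gives a path from 0 to
  \<open>b - 1\<close>, which touches at its start.\<close>

lemma touching_paths_Suc_0:
  "touching_paths (Suc l) 0 b = (#) Up ` (touching_paths l 1 b \<union> touching_paths l 0 (b - 1))"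
  (is "?A = ?B")
proof (intro equalityI subsetI)
  fix w assume "w \<in> ?A"
  then obtain v where "w = Up # v" "length v = l" "stays 1 v" "1 + height v = b"
    by (cases w; cases "hd w") (auto simp: touching_paths_def dest: stays_nonneg)
  then show "w \<in> ?B"
    using stays_iff_not_touches[of 0 v] by (auto simp: touching_paths_def touches_0)
next
  fix w assume "w \<in> ?B"
  then show "w \<in> ?A"
    using stays_iff_not_touches[of 0 "tl w"] by (auto simp: touching_paths_def)
qed

lemma card_touching_paths:
  "l + a + b = 2 * n \<Longrightarrow> rat_of_nat (card (touching_paths l (int a) (int b))) = ballot n (a + b)"
proof (induction l arbitrary: a b n)
  case 0
  have "touching_paths 0 (int a) (int b) = (if a = 0 \<and> b = 0 then {[]} else {})"
    by (auto simp: touching_paths_def)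
  then show ?case using 0 by (auto simp: ballot_double)
next
  case (Suc l)
  then obtain n' where n: "n = Suc n'" by (cases n) auto
  show ?case
  proof (cases a)
    case (Suc a')
    have "card (touching_paths (Suc l) (int a) (int b)) =
        card (touching_paths l (int (Suc a)) (int b)) + card (touching_paths l (int a') (int b))"
      unfolding Suc by (subst touching_paths_Suc_pos; (subst card_Un_disjoint)?)
        (auto simp: finite_touching_paths card_image add.commute)
    \<comment> \<open>An \<open>Up\<close> step trades length for starting height and keeps
      \<open>n\<close>; a \<open>Down\<close> step lowers both and leads to
      \<open>n'\<close>.\<close>
    also have "rat_of_nat \<dots> = ballot n (Suc a + b) + ballot n' (a' + b)"
      unfolding of_nat_add using Suc.IH[of "Suc a" b n] Suc.IH[of a' b n'] Suc.prems n Suc by simp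
    finally show ?thesis using ballot_Suc_Suc[of n' "a' + b"] n Suc by simp
  next
    case 0
    have "touching_paths l 1 (int b) \<inter> touching_paths l 0 (int b - 1) = {}"
      using stays_iff_not_touches[of 0] by (auto simp: touching_paths_def)
    then have *: "card (touching_paths (Suc l) (int a) (int b)) =
        card (touching_paths l 1 (int b)) + card (touching_paths l 0 (int b - 1))"
      using 0 by (simp add: touching_paths_Suc_0 card_image card_Un_disjoint finite_touching_paths)
    have 1: "rat_of_nat (card (touching_paths l 1 (int b))) = ballot n (Suc b)"
      using Suc.IH[of 1 b n] Suc.prems 0 by simp
    show ?thesis
    proof (cases b)
      case b: 0
      \<comment> \<open>No lowered path can end at -1, so a single term remains and
        \<open>ballot_Suc_0\<close> replaces the recurrence.\<close>
      have "touching_paths l 0 (- 1) = {}"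
        by (auto simp: touching_paths_def dest: stays_end)
      then show ?thesis using * 1 0 b n by (simp add: ballot_Suc_0)
    next
      case b: (Suc b')
      have "rat_of_nat (card (touching_paths l 0 (int b'))) = ballot n' b'"
        using Suc.IH[of 0 b' n'] Suc.prems 0 b n by simp
      then show ?thesis using * 1 0 b n ballot_Suc_Suc[of n' b'] by simp
    qed
  qed
qed

section \<open>The class D\<close>

lemma dyck_path_concat: "(\<forall>c\<in>set cs. dyck_path c) \<Longrightarrow> dyck_path (concat cs)"
  by (induction cs) (auto simp: dyck_path_iff)

text \<open>Otherwise \<open>c\<close> is a prefix of the initial run of upsteps; having height 0 it
  is empty, which forces \<open>k = 0\<close>.\<close>

lemma dyck_path_prefix_Ups:
  assumes "dyck_path c" "c @ d = replicate k Up @ v" "0 < k \<longrightarrow> c \<noteq> []"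
  obtains u where "c = replicate k Up @ u"
proof -
  from assms(2) consider us where "c = replicate k Up @ us" | us where "c @ us = replicate k Up"
    by (auto simp: append_eq_append_conv2)
  then show ?thesis
  proof cases
    case 2
    then have "set c \<subseteq> set (replicate k Up)" by (metis Un_upper1 set_append)
    then have "replicate (length c) Up = c" by (auto intro!: replicate_length_same)
    then have "height c = int (length c)" using height_simps(4)[of "length c"] by simp
    then have "c = []" using assms(1) by (simp add: dyck_path_iff)
    then show ?thesis using assms(3) that by auto
  qed (use that in blast)
qed

lemma dyck_path_suffix_Downs:
  assumes "dyck_path d" "c @ d = v @ replicate p Down" "0 < p \<longrightarrow> d \<noteq> []"
  obtains u where "d = u @ replicate p Down"
proof -
  from assms(2) consider us where "d = us @ replicate p Down" | us where "us @ d = replicate p Down"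
    by (auto simp: append_eq_append_conv2)
  then show ?thesis
  proof cases
    case 2
    then have "set d \<subseteq> set (replicate p Down)" by (metis Un_upper2 set_append)
    then have "replicate (length d) Down = d" by (auto intro!: replicate_length_same)
    then have "height d = - int (length d)" using height_simps(5)[of "length d"] by simp
    then have "d = []" using assms(1) by (simp add: dyck_path_iff)
    then show ?thesis using assms(3) that by auto
  qed (use that in blast)
qed

text \<open>For positive \<open>k\<close> and \<open>p\<close>, a cut just before the later
  distinguished component leaves a non-empty component on each side. If \<open>k\<close> or
  \<open>p\<close> is 0, one factor may be empty.\<close>

lemma class_D_split:
  assumes "w \<in> class_D k p"
  obtains c d where "w = c @ d" "dyck_path c" "dyck_path d" "0 < k \<longrightarrow> c \<noteq> []" "0 < p \<longrightarrow> d \<noteq> []"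
proof -
  from assms have w: "dyck_path w" by (simp add: class_D_def class_P_def)
  have nil: "dyck_path []" by (simp add: dyck_path_iff)
  consider "k = 0" | "p = 0" | "0 < k" "0 < p" by auto
  then show ?thesis
  proof cases
    case 1
    have "w = [] \<Longrightarrow> p = 0" using assms by (auto simp: class_D_def class_P_def)
    then show ?thesis using that[of "[]" w] 1 w nil by auto
  next
    case 2
    have "w = [] \<Longrightarrow> k = 0" using assms by (auto simp: class_D_def class_P_def)
    then show ?thesis using that[of w "[]"] 2 w nil by auto
  next
    case 3
    from assms obtain cs i j where cs: "w = concat cs" "\<forall>c\<in>set cs. dyck_path c"
      and ij: "i < length cs" "j < length cs" "i \<noteq> j" "k \<le> semilength (cs ! i)" "p \<le> semilength (cs ! j)"
      by (auto simp: class_D_def)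
    have ne: "cs ! i \<noteq> []" "cs ! j \<noteq> []"
      using ij 3 by (auto simp: semilength_def)
    define a b where "a = min i j" and "b = max i j"
    have ab: "a < b" "b < length cs" "cs ! a \<noteq> []" "cs ! b \<noteq> []"
      using ij ne by (auto simp: a_def b_def min_def max_def)
    have "cs ! a \<in> set (take b cs)" "cs ! b \<in> set (drop b cs)"
      using ab by (auto simp: in_set_conv_nth intro: exI[of _ a] exI[of _ 0])
    then have "concat (take b cs) \<noteq> []" "concat (drop b cs) \<noteq> []"
      using ab by auto
    moreover have "w = concat (take b cs) @ concat (drop b cs)"
      using cs by (metis append_take_drop_id concat_append)
    moreover have "dyck_path (concat (take b cs))" "dyck_path (concat (drop b cs))"
      using cs(2) by (auto intro!: dyck_path_concat dest: in_set_takeD in_set_dropD)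
    ultimately show ?thesis using that by blast
  qed
qed

text \<open>The \<open>k\<close> upsteps lie inside \<open>c\<close> and the \<open>p\<close>
  downsteps inside \<open>d\<close>, so they do not overlap, and the middle part meets the axis at
  the cut.\<close>

lemma class_P_split_core:
  assumes "w \<in> class_P k p"
    and cd: "w = c @ d" "dyck_path c" "dyck_path d" "0 < k \<longrightarrow> c \<noteq> []" "0 < p \<longrightarrow> d \<noteq> []"
  shows "\<exists>v. w = replicate k Up @ v @ replicate p Down \<and>
    stays (int k) v \<and> touches (int k) v \<and> int k + height v = int p"
proof -
  from assms(1) obtain x y where xy: "w = replicate k Up @ x" "w = y @ replicate p Down"
    unfolding class_P_def by blast
  obtain u where u: "c = replicate k Up @ u"
    using dyck_path_prefix_Ups cd xy by metis
  obtain u' where u': "d = u' @ replicate p Down"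
    using dyck_path_suffix_Downs cd xy by metis
  have "w = replicate k Up @ (u @ u') @ replicate p Down" using cd u u' by simp
  moreover have "stays (int k) (u @ u')" "int k + height (u @ u') = int p"
    using cd(2,3) by (auto simp: u u' dyck_path_iff)
  moreover have "touches (int k) (u @ u')"
    unfolding touches_iff_append using cd(2) by (auto simp: u dyck_path_iff)
  ultimately show ?thesis by blast
qed

lemma class_D_iff:
  "w \<in> class_D k p \<longleftrightarrow> (\<exists>v. w = replicate k Up @ v @ replicate p Down \<and>
    stays (int k) v \<and> touches (int k) v \<and> int k + height v = int p)"
proof
  assume w: "w \<in> class_D k p"
  then obtain c d where "w = c @ d" "dyck_path c" "dyck_path d" "0 < k \<longrightarrow> c \<noteq> []" "0 < p \<longrightarrow> d \<noteq> []"
    by (rule class_D_split)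
  moreover have "w \<in> class_P k p" using w by (simp add: class_D_def)
  ultimately show "\<exists>v. w = replicate k Up @ v @ replicate p Down \<and>
    stays (int k) v \<and> touches (int k) v \<and> int k + height v = int p"
    by (intro class_P_split_core)
next
  assume "\<exists>v. w = replicate k Up @ v @ replicate p Down \<and>
    stays (int k) v \<and> touches (int k) v \<and> int k + height v = int p"
  then obtain u u' where w: "w = replicate k Up @ (u @ u') @ replicate p Down"
    and st: "stays (int k) (u @ u')" "int k + height u = 0" "int k + height (u @ u') = int p"
    unfolding touches_iff_append by blast
  let ?c = "replicate k Up @ u" and ?d = "u' @ replicate p Down"
  have cd: "dyck_path ?c" "dyck_path ?d"
    using st by (auto simp: dyck_path_iff intro: stays_replicate)
  \<comment> \<open>Since \<open>u\<close> descends by \<open>k\<close> and \<open>u'\<close>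
    ascends by \<open>p\<close>, their lengths are at least \<open>k\<close> and
    \<open>p\<close>.\<close>
  have "k \<le> semilength ?c" "p \<le> semilength ?d"
    using abs_height_le[of u] abs_height_le[of u'] st by (auto simp: semilength_def)
  then have "\<exists>i<length [?c, ?d]. \<exists>j<length [?c, ?d]. i \<noteq> j \<and>
      k \<le> semilength ([?c, ?d] ! i) \<and> p \<le> semilength ([?c, ?d] ! j)"
    by (intro exI[of _ 0] exI[of _ 1] conjI) auto
  moreover have wc: "w = concat [?c, ?d]" by (simp add: w)
  moreover have "\<forall>x\<in>set [?c, ?d]. dyck_path x" using cd by simp
  moreover have "2 \<le> length [?c, ?d]" by simp
  moreover have "w \<in> class_P k p"
    using dyck_path_concat[of "[?c, ?d]"] cd wc w by (auto simp: class_P_def)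
  ultimately show "w \<in> class_D k p" unfolding class_D_def by blast
qed

lemma class_D_pos:
  assumes "0 < k" "0 < p"
  shows "class_D k p = {w \<in> class_P k p. touches_axis_inside w}"
proof (intro equalityI subsetI)
  fix w assume w: "w \<in> class_D k p"
  then obtain c d where cd: "w = c @ d" "dyck_path c" "0 < k \<longrightarrow> c \<noteq> []" "0 < p \<longrightarrow> d \<noteq> []"
    by (rule class_D_split)
  then have "touches_axis_inside w"
    unfolding touches_axis_inside_def using assms
    by (intro exI[of _ "length c"]) (auto simp: dyck_path_iff)
  then show "w \<in> {w \<in> class_P k p. touches_axis_inside w}"
    using w by (simp add: class_D_def)
next
  fix w assume "w \<in> {w \<in> class_P k p. touches_axis_inside w}"
  then obtain i where i: "0 < i" "i < length w" "height (take i w) = 0" and P: "w \<in> class_P k p"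
    by (auto simp: touches_axis_inside_def)
  define c d where "c = take i w" and "d = drop i w"
  have cd: "c \<noteq> []" "d \<noteq> []" "w = c @ d" using i by (auto simp: c_def d_def)
  have "height c = 0" using i(3) by (simp add: c_def)
  then have "dyck_path c" "dyck_path d"
    using P unfolding cd(3) by (auto simp: class_P_def dyck_path_iff)
  then show "w \<in> class_D k p"
    unfolding class_D_iff using P cd by (intro class_P_split_core[of w k p c d]) auto
qed

lemma num_D_eq_ballot: "rat_of_nat (num_D k p n) = ballot n (k + p)"
\<comment> \<open>The middle part has length \<open>2 * n - k - p\<close>, a subtraction in
  \<open>nat\<close> that must not truncate.\<close>
proof (cases "k + p \<le> 2 * n")
  case True
  let ?f = "\<lambda>v. replicate k Up @ v @ replicate p Down"
  have "{w \<in> class_D k p. length w = 2 * n} = ?f ` touching_paths (2 * n - k - p) (int k) (int p)"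
    using True unfolding class_D_iff touching_paths_def by auto
  moreover have "inj_on ?f A" for A by (simp add: inj_on_def)
  ultimately have "num_D k p n = card (touching_paths (2 * n - k - p) (int k) (int p))"
    by (simp add: num_D_def card_image)
  then show ?thesis using True by (simp add: card_touching_paths)
next
  case False
  then have "{w \<in> class_D k p. length w = 2 * n} = {}"
    by (auto simp: class_D_iff)
  then have "num_D k p n = 0" by (simp only: num_D_def card.empty)
  then show ?thesis using False by (simp add: ballot_gt)
qed

theorem theorem4:
  fixes k p :: nat
  shows "(k \<ge> 1 \<and> p \<ge> 1 \<longrightarrow> class_D k p = {w \<in> class_P k p. touches_axis_inside w}) \<and>
    Abs_fps (\<lambda>n. rat_of_nat (num_D k p n)) = fps_X ^ (p + k) * catalan_fps ^ (k + p + 1) \<and>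
    (\<forall>n. rat_of_nat (num_D k p n) =
       of_nat (k + p + 1) / of_nat (n + 1) * of_nat (binom (2 * int n - int k - int p) n))"
proof (intro conjI impI allI)
  show "class_D k p = {w \<in> class_P k p. touches_axis_inside w}" if "k \<ge> 1 \<and> p \<ge> 1"
    using that by (intro class_D_pos) auto
  show "Abs_fps (\<lambda>n. rat_of_nat (num_D k p n)) = fps_X ^ (p + k) * catalan_fps ^ (k + p + 1)"
    using ballot_fps_eq[of "k + p"] by (simp add: num_D_eq_ballot ballot_fps_def add.commute)
  show "rat_of_nat (num_D k p n) =
      of_nat (k + p + 1) / of_nat (n + 1) * of_nat (binom (2 * int n - int k - int p) n)" for n
    by (simp add: num_D_eq_ballot ballot_def diff_diff_eq)
qed

end
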